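(* There exists an absolute constant $c>0$ such that the following holds. Let $n$ be a positive integer, let $A \subset \{0,1\}^{n}$ have size $|A| = 2^{n-N}$ for some $N \in \mathbb{N}$, and suppose that \[|\partial A| \leq |A| \log_{2}(2^{n}/|A|) + \epsilon |A|,\] where $0<\epsilon \leq c$. Then there exists a codimension-$N$ subcube $C$ of $\{0,1\}^n$ such that \[|A \Delta C| \leq \delta_{1}(\epsilon)|A|,\] where $\delta_{1}(\epsilon)$ is the unique root $x$ of the equation \[x \log_{2}(1/x) = \epsilon\] in the open interval $(0,1/e)$.
   Context: $Q_n$ denotes the $n$-dimensional hypercube graph: its vertex set is $\{0,1\}^n$, and two 0-1 vectors are joined if and only if they differ in exactly one coordinate. For $A \subset \{0,1\}^n$, the edge-boundary $\partial A$ is the set of all edges of $Q_n$ joining a point in $A$ to a point not in $A$. A subcube of $\{0,1\}^n$ is a set of the form $\{x \in \{0,1\}^{n}: x_{i_1}=a_1,\ldots,x_{i_{m}}=a_{m}\}$, where $0 \leq m \leq n$, $i_1<\cdots<i_m$ are coordinates in $[n]=\{1,\ldots,n\}$, and $a_1,\ldots,a_m\in\{0,1\}$ are fixed; $m$ is its codimension and $n-m$ its dimension. $A \Delta C$ denotes the symmetric difference. *)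

theory Defs
  imports Complex_Main "HOL-Library.FuncSet"
begin

definition hypercube :: "nat \<Rightarrow> (nat \<Rightarrow> nat) set" where
  "hypercube n = {1..n} \<rightarrow>\<^sub>E {0, 1}"

definition hypercube_edges :: "nat \<Rightarrow> (nat \<Rightarrow> nat) set set" where
  "hypercube_edges n =
     {{x, y} | x y. x \<in> hypercube n \<and> y \<in> hypercube n \<and> (\<exists>!i. i \<in> {1..n} \<and> x i \<noteq> y i)}"

definition edge_boundary :: "nat \<Rightarrow> (nat \<Rightarrow> nat) set \<Rightarrow> (nat \<Rightarrow> nat) set set" where
  "edge_boundary n A = {e \<in> hypercube_edges n. \<exists>x y. e = {x, y} \<and> x \<in> A \<and> y \<notin> A}"

text \<open>Here \<open>m\<close> is the codimension.\<close>

definition is_subcube :: "nat \<Rightarrow> nat \<Rightarrow> (nat \<Rightarrow> nat) set \<Rightarrow> bool" where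
  "is_subcube n m C \<longleftrightarrow>
     (\<exists>S a. S \<subseteq> {1..n} \<and> card S = m \<and> a \<in> S \<rightarrow> {0, 1} \<and>
            C = {x \<in> hypercube n. \<forall>i\<in>S. x i = a i})"

definition delta1 :: "real \<Rightarrow> real" where
  "delta1 \<epsilon> = (THE x. 0 < x \<and> x < 1 / exp 1 \<and> x * log 2 (1 / x) = \<epsilon>)"

text \<open>The description above is proper exactly for \<open>0 < \<epsilon> < log 2 (exp 1) / exp 1\<close>,
  the range of \<open>x * log 2 (1 / x)\<close> on the open interval.\<close>

lemma delta1_ex1:
  assumes "0 < \<epsilon>" "\<epsilon> < log 2 (exp 1) / exp 1"
  shows "\<exists>!x::real. 0 < x \<and> x < 1 / exp 1 \<and> x * log 2 (1 / x) = \<epsilon>"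
proof -
  define f :: "real \<Rightarrow> real" where "f = (\<lambda>x. x * log 2 (1 / x))"
  have f_eq: "f x = - (x * ln x) / ln 2" if "x > 0" for x
    using that by (simp add: f_def log_def ln_div)
  have mono: "f x < f y" if "0 < x" "x < y" "y \<le> 1 / exp 1" for x y
  proof -
    have "\<exists>z. z > x \<and> z < y \<and> y * ln y - x * ln x = (y - x) * (ln z + 1)"
    proof (rule MVT2[OF \<open>x < y\<close>])
      fix z assume "x \<le> z" "z \<le> y"
      then show "((\<lambda>x. x * ln x) has_real_derivative ln z + 1) (at z)"
        using \<open>0 < x\<close> by (auto intro!: derivative_eq_intros)
    qed
    then obtain z where z: "x < z" "z < y" "y * ln y - x * ln x = (y - x) * (ln z + 1)"
      by blast
    have "ln z < ln (1 / exp 1 :: real)"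
      using z that by (subst ln_less_cancel_iff) auto
    then have "ln z + 1 < 0" by (simp add: ln_div)
    then have "(y - x) * (ln z + 1) < 0" using that by (simp add: mult_pos_neg)
    then have "y * ln y < x * ln x" using z by linarith
    then show ?thesis using that by (simp add: f_eq divide_strict_right_mono)
  qed
  obtain t where t: "0 < t" "t < 1" "t \<le> 1 / exp 1" "t \<le> \<epsilon> * ln 2 / 2"
  proof
    show "0 < min (1 / exp 1) (\<epsilon> * ln 2 / 2)" using assms by simp
    show "min (1 / exp 1) (\<epsilon> * ln 2 / 2) < (1::real)" by (simp add: min_less_iff_disj)
  qed auto
  have "t * t < t" using t by simp
  then have sq: "0 < t\<^sup>2" "t\<^sup>2 < 1 / exp 1"
    unfolding power2_eq_square using t by (simp, linarith)
  have "- ln t < 1 / t"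
    using ln_less_self[of "1 / t"] t by (simp add: ln_div)
  then have "(2 * t\<^sup>2) * (- ln t) < (2 * t\<^sup>2) * (1 / t)"
    using t by (intro mult_strict_left_mono) auto
  also have "(2 * t\<^sup>2) * (1 / t) \<le> \<epsilon> * ln 2"
    using t by (simp add: power2_eq_square)
  finally have low: "f (t\<^sup>2) \<le> \<epsilon>"
    using t sq by (simp add: f_eq ln_realpow field_simps)
  have high: "\<epsilon> < f (1 / exp 1)"
    using assms by (simp add: f_def mult.commute)
  have "\<exists>x. t\<^sup>2 \<le> x \<and> x \<le> 1 / exp 1 \<and> f x = \<epsilon>"
  proof (rule IVT')
    show "continuous_on {t\<^sup>2..1 / exp 1} f"
      unfolding f_def log_def using sq by (intro continuous_intros) auto
  qed (use low high sq in auto)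
  then obtain x where x: "t\<^sup>2 \<le> x" "x \<le> 1 / exp 1" "f x = \<epsilon>" by blast
  have "0 < x" using x sq by linarith
  moreover have "x < 1 / exp 1" using x high by (cases "x = 1 / exp 1") auto
  moreover have "y = x" if "0 < y" "y < 1 / exp 1" "f y = \<epsilon>" for y
    using mono[of x y] mono[of y x] that x \<open>0 < x\<close>
    by (cases x y rule: linorder_cases) auto
  ultimately have "\<exists>!x. 0 < x \<and> x < 1 / exp 1 \<and> f x = \<epsilon>" using x by blast
  then show ?thesis unfolding f_def .
qed

end

theory Submission
  imports Defs
begin

text \<open>Identify a vertex of the cube with the set of its coordinates equal to \<open>1\<close>. Subcubes
  then are the nonempty intervals \<open>{X..Y}\<close> of sets. For a family \<open>A\<close> of sets let the deficit be
  \<open>card A * log 2 (card A)\<close> minus twice the number of edges inside \<open>A\<close>. This is the excess of the edge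
  boundary over the isoperimetric bound, and the hypothesis says that the deficit is at most
  \<open>\<epsilon> * card A\<close>.

  Two facts drive the proof. The first is the behaviour under splitting along a coordinate
  (\<open>deficit_slices\<close>): the deficit of \<open>A\<close> is the sum of the deficits of the two slices, plus
  \<open>card A\<close> times the binary entropy of the splitting ratio \<open>p\<close>, minus twice the size of the
  intersection of the slices. The intersection is no larger than the smaller slice and the entropy
  is at least twice the smaller ratio, so the last two contributions together are nonnegative.
  Induction gives the isoperimetric inequality (\<open>deficit_nonneg\<close>), and a small deficit forces \<open>p\<close> to
  be close to \<open>0\<close>, \<open>1\<close> or \<open>1 / 2\<close>.

  The second fact is a lower bound for the deficit of a family near a cube
  (\<open>deficit_ge_near_cube\<close>), obtained by counting the edges gained and lost in passing from the cube to
  the family. It shows that a family within relative distance \<open>1 / 16\<close> of a cube is in fact within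
  its deficit (\<open>near_cube_self_improves\<close>), and that for a family as large as the cube
  the deficit is at least \<open>card A * (x * log 2 (1 / x))\<close> where \<open>x\<close> is the relative distance
  (\<open>deficit_ge_same_size_cube\<close>).

  Together they give stability by induction on the ground set (\<open>near_cube_of_small_deficit\<close>). Split
  along a coordinate. If one slice is tiny, then the other one has a relative deficit no
  larger than that of \<open>A\<close>, and a cube near it is near \<open>A\<close>. If the slices are almost balanced,
  then they nearly coincide, one of them has a relative deficit no larger than that of \<open>A\<close>, and the
  product of a cube near it with the coordinate direction is near \<open>A\<close>. Both times the distance to
  the cube may have grown, but it is still below the threshold for self-improvement, which restores
  the original constant, so that errors do not accumulate. For \<open>card A\<close> a power of \<open>2\<close> the cube must
  have the size of \<open>A\<close>, and the sharp lower bound at equal size gives the estimate in terms of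
  \<open>delta1\<close> (\<open>near_cube_sharp\<close>).\<close>

section \<open>The function x log x and the binary entropy\<close>

definition xlog :: "real \<Rightarrow> real" where
  "xlog x = x * log 2 x"

definition bin_entropy :: "real \<Rightarrow> real" where
  "bin_entropy p = - xlog p - xlog (1 - p)"

lemma xlog_0 [simp]: "xlog 0 = 0" and xlog_1 [simp]: "xlog 1 = 0"
  by (simp_all add: xlog_def)

lemma xlog_mult:
  assumes "0 < s" "0 \<le> x"
  shows "xlog (s * x) = s * xlog x + s * x * log 2 s"
  using assms by (cases "x = 0") (auto simp: xlog_def log_mult algebra_simps)

lemma DERIV_xlog:
  assumes "0 < x"
  shows "(xlog has_real_derivative (ln x + 1) / ln 2) (at x)"
proof -
  have "((\<lambda>x. x * ln x / ln 2) has_real_derivative (ln x + 1) / ln 2) (at x)"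
    using assms by (auto intro!: derivative_eq_intros)
  then show ?thesis by (simp add: xlog_def[abs_def] log_def)
qed

text \<open>The entropy measures how much \<open>xlog\<close> of a total exceeds the sum of \<open>xlog\<close> over its two
  parts. This is the form in which it enters when a family is split along a coordinate.\<close>

lemma xlog_split:
  assumes "0 < a" "0 \<le> b" "b \<le> a"
  shows "xlog a - xlog (a - b) - xlog b = a * bin_entropy (b / a)"
proof -
  have "xlog b = a * xlog (b / a) + b * log 2 a"
    using xlog_mult[of a "b / a"] assms by simp
  moreover have "xlog (a - b) = a * xlog (1 - b / a) + (a - b) * log 2 a"
  proof -
    have "a - b = a * (1 - b / a)" using assms by (simp add: right_diff_distrib)
    then show ?thesis using xlog_mult[of a "1 - b / a"] assms by simp
  qed
  ultimately show ?thesis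
    by (simp add: bin_entropy_def xlog_def[of a] algebra_simps)
qed

lemma xlog_nonpos: "0 \<le> x \<Longrightarrow> x \<le> 1 \<Longrightarrow> xlog x \<le> 0"
  by (cases "x = 0") (auto simp: xlog_def mult_nonneg_nonpos)

lemma xlog_le_power:
  assumes "0 \<le> x" "x \<le> 1 / 2 ^ k"
  shows "xlog x \<le> - (real k * x)"
proof (cases "x = 0")
  case False
  with assms have "log 2 x \<le> log 2 (1 / 2 ^ k)" by (subst log_le_cancel_iff) auto
  also have "\<dots> = - real k" by (simp add: log_divide log_nat_power)
  finally have "x * log 2 x \<le> x * (- real k)" using assms by (intro mult_left_mono) auto
  then show ?thesis by (simp add: xlog_def algebra_simps)
qed simp

lemma bin_entropy_ge_linear:
  assumes "0 \<le> p" "p \<le> 1 / 2 ^ k"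
  shows "real k * p \<le> bin_entropy p"
proof -
  have "1 / 2 ^ k \<le> (1::real)" by simp
  then have "p \<le> 1" using assms(2) by linarith
  then show ?thesis
    using xlog_le_power[OF assms] xlog_nonpos[of "1 - p"] assms(1)
    by (simp add: bin_entropy_def)
qed

text \<open>The difference \<open>bin_entropy p - 2 * p\<close> vanishes at both ends of \<open>[0, 1/2]\<close> and is strictly
  concave. If it were nonpositive at an inner point, then it would decrease somewhere before this
  point and increase weakly somewhere after it, although its derivative is decreasing.\<close>

lemma bin_entropy_gt:
  assumes "0 < p" "p < 1 / 2"
  shows "2 * p < bin_entropy p"
proof (rule ccontr)
  define F where "F = (\<lambda>p. bin_entropy p - 2 * p)"
  define F' where "F' = (\<lambda>x::real. log 2 (1 - x) - log 2 x - 2)"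
  have deriv: "(F has_real_derivative F' x) (at x)" if "0 < x" "x < 1" for x
  proof -
    have "((\<lambda>x. 1 - x) has_real_derivative - 1) (at x)"
      by (auto intro!: derivative_eq_intros)
    from DERIV_chain2[OF DERIV_xlog this] that
    have "((\<lambda>x. xlog (1 - x)) has_real_derivative (ln (1 - x) + 1) / ln 2 * - 1) (at x)"
      by simp
    from DERIV_diff[OF DERIV_minus[OF DERIV_xlog[OF \<open>0 < x\<close>]] this]
    have "((\<lambda>x. - xlog x - xlog (1 - x)) has_real_derivative log 2 (1 - x) - log 2 x) (at x)"
      by (rule DERIV_cong) (simp add: log_def add_divide_distrib)
    from DERIV_diff[OF this DERIV_cmult_Id[of 2]] show ?thesis
      by (simp add: F_def F'_def bin_entropy_def)
  qed
  assume "\<not> 2 * p < bin_entropy p"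
  then have Fp: "F p \<le> 0" by (simp add: F_def)
  have "F (1 / 2) = 0"
    by (simp add: F_def bin_entropy_def xlog_def log_divide)
  \<comment> \<open>The derivative is infinite at \<open>0\<close>, so the mean value theorem is applied from a small
    \<open>q\<close> at which the linear lower bound \<open>4 * q\<close> for the entropy applies.\<close>
  define q where "q = min (1 / 16) (p / 2)"
  have q: "0 < q" "q < p" "q \<le> 1 / 2 ^ 4" using assms by (auto simp: q_def)
  have "0 < F q" using bin_entropy_ge_linear[of q 4] q by (simp add: F_def)
  obtain u where u: "q < u" "u < p" "F p - F q = (p - q) * F' u"
    using MVT2[OF \<open>q < p\<close>, of F F'] deriv q assms by force
  obtain v where v: "p < v" "v < 1 / 2" "F (1 / 2) - F p = (1 / 2 - p) * F' v"
    using MVT2[OF \<open>p < 1 / 2\<close>, of F F'] deriv assms by force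
  have "(p - q) * F' u < 0" using u Fp \<open>0 < F q\<close> by linarith
  then have "F' u < 0" using q by (simp add: mult_less_0_iff)
  moreover have "0 \<le> (1 / 2 - p) * F' v" using v Fp \<open>F (1 / 2) = 0\<close> by linarith
  then have "0 \<le> F' v" using assms by (simp add: zero_le_mult_iff)
  moreover have "F' v < F' u"
  proof -
    have "log 2 u < log 2 v" "log 2 (1 - v) < log 2 (1 - u)"
      using u v q assms by auto
    then show ?thesis by (simp add: F'_def)
  qed
  ultimately show False by linarith
qed

lemma bin_entropy_ge:
  assumes "0 \<le> p" "p \<le> 1 / 2"
  shows "2 * p \<le> bin_entropy p"
proof -
  have "bin_entropy (1 / 2) = 1" by (simp add: bin_entropy_def xlog_def log_divide)
  moreover have "bin_entropy 0 = 0" by (simp add: bin_entropy_def)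
  moreover have "p = 0 \<or> p = 1 / 2 \<or> (0 < p \<and> p < 1 / 2)" using assms by linarith
  ultimately show ?thesis using bin_entropy_gt[of p] by (elim disjE) (simp_all only:, simp_all)
qed

text \<open>A coordinate that splits a family in proportion \<open>p : 1 - p\<close> with \<open>p\<close> in this range costs a
  fixed fraction of the size of the family. So a family with a small deficit has only very
  unbalanced and almost balanced coordinates. The value of the gap comes from compactness.\<close>

lemma bin_entropy_gap:
  obtains \<gamma> where "0 < \<gamma>" "\<And>p. 1 / 32 \<le> p \<Longrightarrow> p \<le> 31 / 64 \<Longrightarrow> 2 * p + \<gamma> \<le> bin_entropy p"
proof -
  have "continuous_on {1 / 32..31 / 64} (\<lambda>p. bin_entropy p - 2 * p)"
    unfolding bin_entropy_def xlog_def log_def by (intro continuous_intros) auto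
  then obtain q where q: "q \<in> {1 / 32..31 / 64}"
    "\<forall>p\<in>{1 / 32..31 / 64}. bin_entropy q - 2 * q \<le> bin_entropy p - 2 * p"
    using continuous_attains_inf[of "{1 / 32..31 / 64::real}"] by fastforce
  show ?thesis
  proof (rule that)
    show "0 < bin_entropy q - 2 * q" using bin_entropy_gt[of q] q by auto
  qed (use q in force)
qed

lemma xlog_split_min:
  assumes "0 \<le> a" "0 \<le> b"
  shows "2 * min a b \<le> xlog (a + b) - xlog a - xlog b"
proof -
  have *: "2 * b \<le> xlog (a + b) - xlog a - xlog b" if "0 \<le> b" "b \<le> a" for a b
  proof (cases "a + b = 0")
    case False
    then have pos: "0 < a + b" using that by linarith
    have "(a + b) * (2 * (b / (a + b))) \<le> (a + b) * bin_entropy (b / (a + b))"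
      using that pos by (intro mult_left_mono bin_entropy_ge) (auto simp: field_simps)
    then show ?thesis using xlog_split[of "a + b" b] that pos by simp
  next
    case True
    then have "a = 0" "b = 0" using that by auto
    then show ?thesis by simp
  qed
  show ?thesis
    using *[of b a] *[of a b] assms by (cases "b \<le> a") (auto simp: min_def add.commute)
qed

lemma log2_exp_bounds: "1 \<le> log 2 (exp 1)" "log 2 (exp 1) \<le> 2"
proof -
  have "exp 1 \<le> (2::real) ^ 2" using exp_le by simp
  then have "log 2 (exp 1) \<le> log 2 (2 ^ 2)" by (subst log_le_cancel_iff) auto
  also have "\<dots> = 2" by (subst log_nat_power) auto
  finally show "log 2 (exp 1) \<le> 2" .
  have "(2::real) \<le> exp 1" using exp_ge_add_one_self[of 1] by simp
  then have "log 2 2 \<le> log 2 (exp 1)" by (subst log_le_cancel_iff) auto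
  moreover have "log 2 2 = (1::real)" by simp
  ultimately show "1 \<le> log 2 (exp 1)" by linarith
qed

text \<open>The tangent of the convex function \<open>xlog\<close> at \<open>1\<close> has slope \<open>log 2 (exp 1)\<close>.\<close>

lemma xlog_tangent:
  assumes "0 \<le> x"
  shows "(x - 1) * log 2 (exp 1) \<le> xlog x"
proof (cases "x = 0")
  case False
  then have pos: "0 < x" using assms by simp
  have "ln (1 / x) \<le> 1 / x - 1" using pos by (intro ln_le_minus_one) auto
  then have "1 - 1 / x \<le> ln x" using pos by (simp add: ln_div)
  then have "x * (1 - 1 / x) \<le> x * ln x" using pos by (intro mult_left_mono) auto
  then have "x - 1 \<le> x * ln x" using pos by (simp add: algebra_simps)
  then have "(x - 1) / ln 2 \<le> x * ln x / ln 2" by (intro divide_right_mono) auto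
  then show ?thesis by (simp add: xlog_def log_def)
qed (use log2_exp_bounds in simp)

lemma xlog_one_over_strict_mono:
  assumes "0 < x" "x < y" "y < 1 / exp 1"
  shows "x * log 2 (1 / x) < y * log 2 (1 / y)"
proof -
  have "- xlog x < - xlog y"
  proof (rule DERIV_pos_imp_increasing[OF \<open>x < y\<close>])
    fix z assume z: "x \<le> z" "z \<le> y"
    have "ln z < ln (1 / exp 1)" using z assms by (subst ln_less_cancel_iff) auto
    then have "ln z + 1 < 0" by (simp add: ln_div)
    moreover have "((\<lambda>z. - xlog z) has_real_derivative - ((ln z + 1) / ln 2)) (at z)"
      using z assms by (intro DERIV_minus DERIV_xlog) auto
    ultimately show "\<exists>d. ((\<lambda>z. - xlog z) has_real_derivative d) (at z) \<and> 0 < d"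
      by (intro exI conjI) (auto simp: divide_neg_pos)
  qed
  then show ?thesis using assms by (simp add: xlog_def log_divide)
qed

lemma le_delta1:
  assumes "0 < \<epsilon>" "\<epsilon> < log 2 (exp 1) / exp 1"
    and "0 \<le> x" "x < 1 / exp 1" "x * log 2 (1 / x) \<le> \<epsilon>"
  shows "x \<le> delta1 \<epsilon>"
proof -
  have d: "0 < delta1 \<epsilon>" "delta1 \<epsilon> < 1 / exp 1" "delta1 \<epsilon> * log 2 (1 / delta1 \<epsilon>) = \<epsilon>"
    using theI'[OF delta1_ex1[OF assms(1,2)]] unfolding delta1_def by auto
  show ?thesis
    using xlog_one_over_strict_mono[of "delta1 \<epsilon>" x] d assms by linarith
qed

section \<open>Edges inside families of sets\<close>

definition toggle :: "'a \<Rightarrow> 'a set \<Rightarrow> 'a set" where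
  "toggle i S = (if i \<in> S then S - {i} else insert i S)"

text \<open>For \<open>A = B\<close> this is twice the number of edges inside \<open>A\<close>. Counting a vertex together with a
  direction, not unordered pairs, makes the count additive over disjoint unions in each argument.\<close>

definition links :: "'a set set \<Rightarrow> 'a set set \<Rightarrow> nat" where
  "links A B = card {(S, i). S \<in> A \<and> toggle i S \<in> B}"

lemma toggle_toggle [simp]: "toggle i (toggle i S) = S"
  by (auto simp: toggle_def)

lemma toggle_inj: "toggle i S = toggle j S \<Longrightarrow> i = j"
  by (auto simp: toggle_def split: if_splits)

lemma toggle_subset: "S \<subseteq> U \<Longrightarrow> i \<in> U \<Longrightarrow> toggle i S \<subseteq> U"
  by (auto simp: toggle_def)

lemma finite_links [simp]:
  assumes "finite A" "finite B"
  shows "finite {(S, i). S \<in> A \<and> toggle i S \<in> B}"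
proof (rule finite_imageD)
  show "finite ((\<lambda>(S, i). (S, toggle i S)) ` {(S, i). S \<in> A \<and> toggle i S \<in> B})"
    by (rule finite_subset[of _ "A \<times> B"]) (use assms in auto)
  show "inj_on (\<lambda>(S, i). (S, toggle i S)) {(S, i). S \<in> A \<and> toggle i S \<in> B}"
    by (auto simp: inj_on_def dest: toggle_inj)
qed

lemma links_commute: "links A B = links B A"
  unfolding links_def
  by (rule bij_betw_same_card[of "\<lambda>(S, i). (toggle i S, i)"],
      rule bij_betw_byWitness[where f' = "\<lambda>(S, i). (toggle i S, i)"]) auto

lemma links_Un_left:
  assumes "finite A" "finite B" "finite C" "A \<inter> B = {}"
  shows "links (A \<union> B) C = links A C + links B C"
proof -
  have "{(S, i). S \<in> A \<union> B \<and> toggle i S \<in> C} =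
    {(S, i). S \<in> A \<and> toggle i S \<in> C} \<union> {(S, i). S \<in> B \<and> toggle i S \<in> C}" by auto
  then show ?thesis
    unfolding links_def using assms by (simp only:, subst card_Un_disjoint) auto
qed

lemma links_Un:
  assumes "finite A" "finite B" "A \<inter> B = {}"
  shows "links (A \<union> B) (A \<union> B) = links A A + 2 * links A B + links B B"
  using assms links_Un_left[of A B "A \<union> B"] links_Un_left[of A B A] links_Un_left[of A B B]
  by (simp add: links_commute[of A "A \<union> B"] links_commute[of B "A \<union> B"] links_commute[of B A])

lemma links_mono:
  assumes "finite B" "finite C" "B \<subseteq> C" "finite A"
  shows "links A B \<le> links A C"
  unfolding links_def using assms by (intro card_mono) auto

lemma links_in_cube:
  assumes "finite Y" "F \<subseteq> {X..Y}"
  shows "links F {X..Y} = card (Y - X) * card F"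
proof -
  have "toggle i S \<in> {X..Y} \<longleftrightarrow> i \<in> Y - X" if "S \<in> F" for S i
  proof -
    have "S \<in> {X..Y}" using that assms(2) by blast
    then have "X \<subseteq> S" "S \<subseteq> Y" by auto
    then show ?thesis by (auto simp: toggle_def)
  qed
  then have "{(S, i). S \<in> F \<and> toggle i S \<in> {X..Y}} = F \<times> (Y - X)" by blast
  then show ?thesis by (simp add: links_def card_cartesian_product)
qed

text \<open>A set outside the cube violates one of the constraints at some element, and a toggle can repair
  this only at that very element. So every vertex outside a cube has at most one neighbour in it.\<close>

lemma links_to_cube_le:
  assumes "finite B" "B \<inter> {X..Y} = {}"
  shows "links B {X..Y} \<le> card B"
  unfolding links_def
proof (rule card_inj_on_le)
  have "i = j" if "S \<in> B" "toggle i S \<in> {X..Y}" "toggle j S \<in> {X..Y}" for S i j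
  proof -
    have "S \<notin> {X..Y}" using that(1) assms(2) by blast
    then obtain x where "x \<in> X - S \<or> x \<in> S - Y" by auto
    then have "i = x" "j = x" using that(2,3) by (auto simp: toggle_def split: if_splits)
    then show ?thesis by simp
  qed
  then show "inj_on fst {(S, i). S \<in> B \<and> toggle i S \<in> {X..Y}}"
    by (auto simp: inj_on_def)
qed (use assms in auto)

lemma cube_subset_Pow:
  fixes X Y U :: "'a set"
  assumes "Y \<subseteq> U"
  shows "{X..Y} \<subseteq> Pow U"
proof
  fix S assume "S \<in> {X..Y}"
  then show "S \<in> Pow U" using assms by (auto intro: order.trans)
qed

lemma finite_cube:
  fixes X Y :: "'a set"
  assumes "finite Y"
  shows "finite {X..Y}"
  by (rule finite_subset[OF cube_subset_Pow[OF order.refl]]) (use assms in simp)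

lemma card_cube:
  assumes "finite Y" "X \<subseteq> Y"
  shows "card {X..Y} = 2 ^ card (Y - X)"
proof -
  have "bij_betw (\<lambda>S. S \<union> X) (Pow (Y - X)) {X..Y}"
    by (rule bij_betw_byWitness[where f' = "\<lambda>S. S - X"]) (use assms in auto)
  from bij_betw_same_card[OF this] show ?thesis using assms by (simp add: card_Pow)
qed

section \<open>Splitting a family along a coordinate\<close>

definition lower :: "'a \<Rightarrow> 'a set set \<Rightarrow> 'a set set" where
  "lower i A = {S \<in> A. i \<notin> S}"

text \<open>The element \<open>i\<close> is removed, so that both slices live on the same smaller ground set and can be
  compared with each other.\<close>

definition upper :: "'a \<Rightarrow> 'a set set \<Rightarrow> 'a set set" where
  "upper i A = {S. i \<notin> S \<and> insert i S \<in> A}"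

lemma upper_image: "insert i ` upper i A = {S \<in> A. i \<in> S}"
proof -
  have "S \<in> insert i ` upper i A" if "S \<in> A" "i \<in> S" for S
    using that by (intro image_eqI[of _ _ "S - {i}"]) (auto simp: upper_def insert_absorb)
  then show ?thesis by (auto simp: upper_def)
qed

lemma inj_on_insert_upper: "inj_on (insert i) (upper i A)"
  by (auto simp: inj_on_def upper_def)

lemma finite_lower [simp]: "finite A \<Longrightarrow> finite (lower i A)"
  by (simp add: lower_def)

lemma finite_upper [simp]: "finite A \<Longrightarrow> finite (upper i A)"
  by (rule finite_imageD[OF _ inj_on_insert_upper]) (simp add: upper_image)

lemma slices_Un: "lower i A \<union> insert i ` upper i A = A"
  by (auto simp: upper_image lower_def)

lemma slices_disjoint: "lower i A \<inter> insert i ` upper i A = {}"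
  by (auto simp: lower_def)

lemma card_slices:
  assumes "finite A"
  shows "card A = card (lower i A) + card (upper i A)"
  using card_Un_disjoint[OF _ _ slices_disjoint[of i A]] assms
  by (simp add: slices_Un card_image inj_on_insert_upper)

lemma toggle_in_insert_image_iff:
  assumes "i \<notin> S"
  shows "toggle j S \<in> insert i ` upper i A \<longleftrightarrow> j = i \<and> S \<in> upper i A"
proof -
  have "toggle j S \<in> insert i ` upper i A \<longleftrightarrow> i \<in> toggle j S \<and> toggle j S \<in> A"
    by (auto simp: upper_image)
  moreover have "i \<in> toggle j S \<longleftrightarrow> j = i" using assms by (auto simp: toggle_def)
  ultimately show ?thesis using assms by (auto simp: toggle_def upper_def)
qed

lemma links_lower_upper:
  "links (lower i A) (insert i ` upper i A) = card (lower i A \<inter> upper i A)"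
proof -
  have "toggle j S \<in> insert i ` upper i A \<longleftrightarrow> j = i \<and> S \<in> upper i A" if "S \<in> lower i A" for S j
    using that by (intro toggle_in_insert_image_iff) (simp add: lower_def)
  then have "{(S, j). S \<in> lower i A \<and> toggle j S \<in> insert i ` upper i A}
      = (lower i A \<inter> upper i A) \<times> {i}"
    by blast
  then show ?thesis by (simp add: links_def card_cartesian_product)
qed

lemma links_insert_upper:
  "links (insert i ` upper i A) (insert i ` upper i A) = links (upper i A) (upper i A)"
proof -
  let ?f = "\<lambda>(S, j). (insert i S, j)"
  let ?Q = "{(S, j). S \<in> upper i A \<and> toggle j S \<in> upper i A}"
  let ?Z = "{(S, j). S \<in> insert i ` upper i A \<and> toggle j S \<in> insert i ` upper i A}"
  have comm: "toggle j (insert i S) = insert i (toggle j S)" if "i \<noteq> j" for j S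
    using that by (auto simp: toggle_def)
  have mem: "i \<in> toggle j S \<longleftrightarrow> i \<in> S" if "i \<noteq> j" for j S
    using that by (simp add: toggle_def)
  have neq: "i \<noteq> j" if "i \<notin> S" "i \<notin> toggle j S" for j S
    using that by (auto simp: toggle_def)
  have neq': "i \<noteq> j" if "i \<in> S" "i \<in> toggle j S" for j S
    using that by (auto simp: toggle_def)
  have "?f ` ?Q = ?Z"
  proof (intro equalityI subsetI)
    fix z assume "z \<in> ?f ` ?Q"
    then obtain S j where z: "z = (insert i S, j)" "S \<in> upper i A" "toggle j S \<in> upper i A" by auto
    then have "i \<noteq> j" by (intro neq[of S]) (auto simp: upper_def)
    then show "z \<in> ?Z" using z by (simp add: comm)
  next
    fix z assume "z \<in> ?Z"
    then obtain S j where z: "z = (insert i S, j)" "S \<in> upper i A"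
      "toggle j (insert i S) \<in> insert i ` upper i A" by auto
    then have "i \<noteq> j" by (intro neq'[of "insert i S"]) auto
    moreover have "i \<notin> S" using z by (simp add: upper_def)
    ultimately have "toggle j S \<in> upper i A"
      using z(3) by (auto simp: comm upper_def mem)
    then show "z \<in> ?f ` ?Q" using z by (intro image_eqI[of _ _ "(S, j)"]) auto
  qed
  moreover have "inj_on ?f ?Q" using inj_on_insert_upper[of i A] by (auto simp: inj_on_def)
  then have "card (?f ` ?Q) = card ?Q" by (rule card_image)
  ultimately show ?thesis unfolding links_def by (simp only:)
qed

text \<open>An edge inside \<open>A\<close> either stays within one slice or runs in direction \<open>i\<close>. The edges of the
  second kind correspond to the sets that belong to both slices.\<close>

lemma links_slices:
  assumes "finite A"
  shows "links A A = links (lower i A) (lower i A) + links (upper i A) (upper i A)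
    + 2 * card (lower i A \<inter> upper i A)"
  using links_Un[OF _ _ slices_disjoint[of i A]] assms
  by (simp add: slices_Un links_lower_upper links_insert_upper)

lemma slices_sym_diff:
  "lower i (sym_diff A B) = sym_diff (lower i A) (lower i B)"
  "upper i (sym_diff A B) = sym_diff (upper i A) (upper i B)"
  by (auto simp: lower_def upper_def)

lemma slices_cube:
  assumes "i \<notin> Y" "X \<subseteq> Y"
  shows "lower i {X..Y} = {X..Y}" "upper i {X..Y} = {}"
    and "lower i {insert i X..insert i Y} = {}" "upper i {insert i X..insert i Y} = {X..Y}"
    and "lower i {X..insert i Y} = {X..Y}" "upper i {X..insert i Y} = {X..Y}"
proof -
  have mem: "S \<in> lower i {V..W} \<longleftrightarrow> V \<subseteq> S \<and> S \<subseteq> W \<and> i \<notin> S"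
    "S \<in> upper i {V..W} \<longleftrightarrow> i \<notin> S \<and> V \<subseteq> insert i S \<and> insert i S \<subseteq> W"
    "S \<in> {V..W} \<longleftrightarrow> V \<subseteq> S \<and> S \<subseteq> W" for S V W
    by (simp_all add: lower_def upper_def)
  have "i \<notin> X" using assms by blast
  then have ins: "X \<subseteq> insert i S \<longleftrightarrow> X \<subseteq> S" for S by (rule subset_insert)
  have ins': "S \<subseteq> insert i Y \<and> i \<notin> S \<longleftrightarrow> S \<subseteq> Y" for S using assms(1) by blast
  have notin: "S \<subseteq> Y \<Longrightarrow> i \<notin> S" for S using assms(1) by blast
  show "lower i {X..Y} = {X..Y}" by (rule set_eqI) (unfold mem, use notin in blast)
  show "upper i {X..Y} = {}"
    by (rule equals0I) (unfold mem, use assms(1) in blast)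
  show "lower i {insert i X..insert i Y} = {}"
    by (rule equals0I) (unfold mem, blast)
  show "upper i {insert i X..insert i Y} = {X..Y}"
    by (rule set_eqI) (unfold mem insert_subset ins, use ins' in blast)
  show "lower i {X..insert i Y} = {X..Y}" by (rule set_eqI) (unfold mem, use ins' in blast)
  show "upper i {X..insert i Y} = {X..Y}"
    by (rule set_eqI) (unfold mem insert_subset ins, use ins' in blast)
qed

section \<open>The size of the symmetric difference\<close>

definition sym_dist :: "'a set \<Rightarrow> 'a set \<Rightarrow> nat" where
  "sym_dist A B = card (sym_diff A B)"

lemma sym_dist_triangle:
  assumes "finite A" "finite B" "finite C"
  shows "sym_dist A C \<le> sym_dist A B + sym_dist B C"
proof -
  have "card (sym_diff A C) \<le> card (sym_diff A B \<union> sym_diff B C)"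
    using assms by (intro card_mono) auto
  also have "\<dots> \<le> card (sym_diff A B) + card (sym_diff B C)" by (rule card_Un_le)
  finally show ?thesis by (simp add: sym_dist_def)
qed

lemma sym_dist_commute: "sym_dist A B = sym_dist B A"
  by (simp add: sym_dist_def Un_commute)

lemma sym_dist_eq:
  assumes "finite A" "finite B"
  shows "real (sym_dist A B) = real (card A) + real (card B) - 2 * real (card (A \<inter> B))"
proof -
  have "card A = card (A \<inter> B) + card (A - B)" "card B = card (A \<inter> B) + card (B - A)"
    using assms by (metis Int_commute card_Int_Diff)+
  moreover have "sym_dist A B = card (A - B) + card (B - A)"
    unfolding sym_dist_def using assms by (subst card_Un_disjoint) auto
  ultimately show ?thesis by simp
qed

section \<open>The isoperimetric deficit\<close>

text \<open>For a family of subsets of an \<open>n\<close>-element set this is the size of the edge boundary minus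
  \<open>card A * log 2 (2 ^ n / card A)\<close>. The number \<open>n\<close> cancels because boundary edges and twice the inner
  edges together make \<open>n * card A\<close>, so the deficit does not depend on the ground set.\<close>

definition deficit :: "'a set set \<Rightarrow> real" where
  "deficit A = xlog (card A) - links A A"

lemma deficit_slices:
  assumes "finite A"
  shows "deficit A = deficit (lower i A) + deficit (upper i A)
    + (xlog (real (card (lower i A)) + real (card (upper i A)))
       - xlog (card (lower i A)) - xlog (card (upper i A)))
    - 2 * real (card (lower i A \<inter> upper i A))"
  using links_slices[OF assms, of i] card_slices[OF assms, of i]
  by (simp add: deficit_def)

lemma slices_Pow:
  assumes "A \<subseteq> Pow (insert i U)"
  shows "lower i A \<subseteq> Pow U" "upper i A \<subseteq> Pow U"
  using assms by (auto simp: lower_def upper_def)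

text \<open>This is the edge isoperimetric inequality. When a family is split along a coordinate, the entropy
  term is at least twice the size of the smaller slice, and this bounds the number of edges in the
  direction of the coordinate.\<close>

lemma deficit_nonneg:
  assumes "finite U" "A \<subseteq> Pow U"
  shows "0 \<le> deficit A"
  using assms
proof (induction U arbitrary: A rule: finite_induct)
  case empty
  then consider "A = {}" | "A = {{}}" by auto
  moreover have "{(S, i). S \<in> {{}} \<and> toggle i S \<in> {{} :: 'a set}} = {}"
    by (auto simp: toggle_def)
  then have "links {{}} {{} :: 'a set} = 0" by (simp only: links_def card.empty)
  moreover have "links {} {} = 0" by (simp add: links_def)
  ultimately show ?case by cases (auto simp: deficit_def)
next
  case (insert i U)
  have fin: "finite A" using insert by (meson finite_Pow_iff finite_insert finite_subset)
  let ?L = "lower i A" and ?U = "upper i A"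
  have "card (?L \<inter> ?U) \<le> min (card ?L) (card ?U)" using fin by (simp add: card_mono)
  then have "2 * real (card (?L \<inter> ?U)) \<le> 2 * min (real (card ?L)) (real (card ?U))" by linarith
  also have "\<dots> \<le> xlog (real (card ?L) + real (card ?U)) - xlog (card ?L) - xlog (card ?U)"
    by (rule xlog_split_min) auto
  finally show ?case
    using deficit_slices[OF fin, of i] insert.IH[OF slices_Pow(1)[OF insert.prems]]
      insert.IH[OF slices_Pow(2)[OF insert.prems]] by linarith
qed

text \<open>Remove the missing part \<open>F = {X..Y} - A\<close> from the cube and add the surplus \<open>B = A - {X..Y}\<close>. The
  cube is regular of degree \<open>t\<close>, which determines the edges that are lost with \<open>F\<close> up to the edges
  inside \<open>F\<close>. The edges gained with \<open>B\<close> lie inside \<open>B\<close> or join \<open>B\<close> to the cube, at most one for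
  every vertex. The edges inside \<open>F\<close> and \<open>B\<close> are bounded by the isoperimetric inequality.\<close>

lemma deficit_ge_near_cube:
  fixes A :: "'a set set"
  assumes "finite U" "A \<subseteq> Pow U" "X \<subseteq> Y" "Y \<subseteq> U"
  defines "t \<equiv> real (card (Y - X))"
    and "f \<equiv> real (card ({X..Y} - A))" and "b \<equiv> real (card (A - {X..Y}))"
  shows "xlog (card A) - t * 2 ^ card (Y - X) + 2 * t * f - xlog f - xlog b - 2 * b \<le> deficit A"
proof -
  have finY: "finite Y" using assms finite_subset by blast
  have sub: "{X..Y} \<subseteq> Pow U" by (rule cube_subset_Pow[OF assms(4)])
  have fin: "finite A" "finite {X..Y}"
    using assms(1,2) sub by (meson finite_Pow_iff finite_subset)+
  define E F B where "E = A \<inter> {X..Y}" and "F = {X..Y} - A" and "B = A - {X..Y}"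
  have fins: "finite E" "finite F" "finite B" using fin by (auto simp: E_def F_def B_def)
  have C: "{X..Y} = E \<union> F" and A: "A = E \<union> B" and dis: "E \<inter> F = {}" "E \<inter> B = {}"
    by (auto simp: E_def F_def B_def)
  have CC: "links E E + 2 * links E F + links F F = card (Y - X) * 2 ^ card (Y - X)"
    using links_Un[of E F] links_in_cube[OF finY order.refl, of X] fins dis card_cube[OF finY assms(3)]
    by (simp flip: C)
  have FC: "links E F + links F F = card (Y - X) * card F"
    using links_Un_left[of E F F] links_in_cube[OF finY, of F X] fins dis links_commute[of F "{X..Y}"]
    by (simp add: C)
  have AA: "links A A = links E E + 2 * links E B + links B B"
    using links_Un[of E B] fins dis by (simp flip: A)
  have "links E B \<le> links B {X..Y}"
    unfolding links_commute[of E B] using fins fin by (intro links_mono) (auto simp: E_def)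
  also have "\<dots> \<le> card B" using fins by (intro links_to_cube_le) (auto simp: B_def)
  finally have EB: "real (links E B) \<le> b" by (simp add: b_def B_def)
  have "F \<subseteq> Pow U" "B \<subseteq> Pow U" using sub assms by (auto simp: F_def B_def)
  then have FFBB: "links F F \<le> xlog f" "links B B \<le> xlog b"
    using deficit_nonneg[OF assms(1), of F] deficit_nonneg[OF assms(1), of B]
    by (auto simp: deficit_def f_def b_def F_def B_def)
  have "real (links E E) + 2 * real (links E F) + real (links F F) = t * 2 ^ card (Y - X)"
    unfolding t_def using arg_cong[OF CC, of real] by simp
  moreover have "real (links E F) + real (links F F) = t * f"
    unfolding t_def using arg_cong[OF FC, of real] by (simp add: f_def F_def)
  ultimately show ?thesis
    using EB FFBB AA by (simp add: deficit_def algebra_simps)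
qed

text \<open>In \<open>deficit_ge_near_cube\<close> the terms \<open>- xlog f\<close> and \<open>- xlog b\<close>, taken relative to the size of the
  cube, dominate the terms that are linear in \<open>f\<close> and \<open>b\<close> once these are small. Hence a rough
  approximation by a cube is automatically a good one, and a loss of constants in an inductive
  argument can be repaired after every step.\<close>

lemma near_cube_self_improves:
  assumes "finite U" "A \<subseteq> Pow U" "X \<subseteq> Y" "Y \<subseteq> U"
    and close: "16 * sym_dist A {X..Y} \<le> card A"
  shows "sym_dist A {X..Y} \<le> deficit A"
proof -
  define t where "t = real (card (Y - X))"
  define T :: real where "T = 2 ^ card (Y - X)"
  define f where "f = real (card ({X..Y} - A))"
  define b where "b = real (card (A - {X..Y}))"
  define a where "a = real (card A)"
  have finY: "finite Y" using assms finite_subset by blast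
  have fin: "finite A" "finite {X..Y}"
    using assms(1,2) finite_cube[OF finY] by (meson finite_Pow_iff finite_subset)+
  have sd: "real (sym_dist A {X..Y}) = b + f"
    unfolding f_def b_def sym_dist_def using fin by (subst card_Un_disjoint) auto
  have "card {X..Y} = card (A \<inter> {X..Y}) + card ({X..Y} - A)"
    "card A = card (A \<inter> {X..Y}) + card (A - {X..Y})"
    using fin by (metis Int_commute card_Int_Diff)+
  then have a: "a = T - f + b"
    using arg_cong[OF card_cube[OF finY assms(3)], of real] by (simp add: a_def f_def b_def T_def)
  have pos: "0 < T" "0 \<le> f" "0 \<le> b" "0 \<le> a" by (auto simp: T_def f_def b_def a_def)
  have "real (16 * sym_dist A {X..Y}) \<le> real (card A)" using close by (simp only: of_nat_le_iff)
  then have close': "16 * b + 16 * f \<le> a" by (simp add: sd a_def)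
  define lam where "lam = log 2 (exp 1)"
  \<comment> \<open>The bound \<open>T / 8\<close> puts \<open>- log 2\<close> of the relative sizes above \<open>3\<close>, which outweighs the loss of
    \<open>2 * b\<close> and the slope \<open>lam \<le> 2\<close> of the tangent.\<close>
  have small: "f \<le> T / 8" "b \<le> T / 8" using close' a pos by linarith+
  have logT: "log 2 T = t" by (simp add: T_def t_def log_nat_power)
  have rescale: "xlog y = T * xlog (y / T) + y * t" if "0 \<le> y" for y
    using xlog_mult[of T "y / T"] that pos logT by simp
  have "T * xlog (y / T) \<le> - (3 * y)" if "0 \<le> y" "y \<le> T / 8" for y
  proof -
    have "xlog (y / T) \<le> - (real 3 * (y / T))"
      using that pos by (intro xlog_le_power) (auto simp: field_simps)
    then have "T * xlog (y / T) \<le> T * - (real 3 * (y / T))" using pos by (intro mult_left_mono) auto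
    then show ?thesis using pos by simp
  qed
  then have "xlog f \<le> f * t - 3 * f" "xlog b \<le> b * t - 3 * b"
    using rescale[of f] rescale[of b] pos small by (smt (verit))+
  moreover have "(a - T) * lam + a * t \<le> xlog a"
  proof -
    have "T * ((a / T - 1) * lam) \<le> T * xlog (a / T)"
      unfolding lam_def using pos by (intro mult_left_mono xlog_tangent) auto
    moreover have "T * ((a / T - 1) * lam) = (a - T) * lam"
      using pos by (simp add: algebra_simps)
    ultimately show ?thesis using rescale[of a] pos by simp
  qed
  moreover have "xlog a - t * T + 2 * t * f - xlog f - xlog b - 2 * b \<le> deficit A"
    using deficit_ge_near_cube[OF assms(1-4)] by (simp add: a_def t_def T_def f_def b_def)
  ultimately have "b * (1 + lam) + f * (3 - lam) \<le> deficit A"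
    by (simp add: a algebra_simps)
  moreover have "b * 1 \<le> b * (1 + lam)" "f * 1 \<le> f * (3 - lam)"
    using log2_exp_bounds pos unfolding lam_def by (intro mult_left_mono; linarith)+
  ultimately show ?thesis using sd by linarith
qed

text \<open>If the family and the cube have equal size, then \<open>f = b = x * card A / 2\<close>, the linear terms of
  \<open>deficit_ge_near_cube\<close> cancel exactly, and the lower bound takes the sharp form that defines
  \<open>delta1\<close>.\<close>

lemma deficit_ge_same_size_cube:
  assumes "finite U" "A \<subseteq> Pow U" "X \<subseteq> Y" "Y \<subseteq> U" and card_eq: "card A = card {X..Y}"
  defines "x \<equiv> real (sym_dist A {X..Y}) / real (card A)"
  shows "card A * (x * log 2 (1 / x)) \<le> deficit A"
proof -
  define t where "t = real (card (Y - X))"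
  define T :: real where "T = 2 ^ card (Y - X)"
  define m where "m = real (card (A - {X..Y}))"
  have finY: "finite Y" using assms finite_subset by blast
  have fin: "finite A" "finite {X..Y}"
    using assms(1,2) finite_cube[OF finY] by (meson finite_Pow_iff finite_subset)+
  have T: "real (card A) = T" "0 < T" using card_cube[OF finY assms(3)] card_eq by (auto simp: T_def)
  have "card {X..Y} = card (A \<inter> {X..Y}) + card ({X..Y} - A)"
    "card A = card (A \<inter> {X..Y}) + card (A - {X..Y})"
    using fin by (metis Int_commute card_Int_Diff)+
  then have m: "real (card ({X..Y} - A)) = m" using card_eq by (simp add: m_def)
  have "sym_dist A {X..Y} = card (A - {X..Y}) + card ({X..Y} - A)"
    unfolding sym_dist_def using fin by (subst card_Un_disjoint) auto
  then have x: "x = 2 * m / T" using m T by (simp add: x_def m_def)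
  have logT: "log 2 T = t" by (simp add: T_def t_def log_nat_power)
  have "T * (x * log 2 (1 / x)) = 2 * t * m - 2 * xlog m - 2 * m"
  proof (cases "m = 0")
    case False
    then have "0 < m" by (simp add: m_def)
    have "T * (x * log 2 (1 / x)) = 2 * m * log 2 (T / (2 * m))" using T by (simp add: x)
    also have "log 2 (T / (2 * m)) = t - 1 - log 2 m"
      using T \<open>0 < m\<close> logT by (simp add: log_divide log_mult)
    finally show ?thesis by (simp add: xlog_def algebra_simps)
  qed (simp add: x)
  moreover have "xlog T = t * T" by (simp add: xlog_def logT)
  moreover have "xlog T - t * T + 2 * t * m - xlog m - xlog m - 2 * m \<le> deficit A"
    using deficit_ge_near_cube[OF assms(1-4)] m T by (simp add: t_def T_def m_def)
  ultimately show ?thesis unfolding T(1) by linarith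
qed

section \<open>Stability for families of sets\<close>

text \<open>The inductive step, stated for the larger slice \<open>P\<close> and the smaller slice \<open>Q\<close>; \<open>r\<close> is the relative
  size of \<open>Q\<close>. If \<open>r\<close> is small, then the entropy term exceeds the number of crossing edges by so
  much that \<open>P\<close> inherits the relative bound on the deficit, and a cube near \<open>P\<close> also serves the
  whole family because \<open>Q\<close> is tiny. Otherwise \<open>r\<close> is close to \<open>1 / 2\<close> by the entropy gap, so
  the slices have almost the same size and nearly coincide. One of them inherits the bound on the
  deficit, and a cube near this one is near the other as well.\<close>

lemma cube_for_slices:
  fixes P Q :: "'a set set" and c \<gamma> :: real
  assumes gap: "\<And>r. 1 / 32 \<le> r \<Longrightarrow> r \<le> 31 / 64 \<Longrightarrow> 2 * r + \<gamma> \<le> bin_entropy r"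
    and c: "0 < c" "c \<le> 1 / 100" "c < \<gamma>"
    and U: "finite U" "P \<subseteq> Pow U" "Q \<subseteq> Pow U"
    and le: "card Q \<le> card P" and "P \<noteq> {}"
    and deficit: "deficit P + deficit Q
      + (xlog (real (card P) + real (card Q)) - xlog (card P) - xlog (card Q))
      - 2 * real (card (P \<inter> Q)) \<le> c * (real (card P) + real (card Q))"
    and IH: "\<And>R. R \<subseteq> Pow U \<Longrightarrow> R \<noteq> {} \<Longrightarrow> deficit R \<le> c * card R \<Longrightarrow>
      \<exists>X Y. X \<subseteq> Y \<and> Y \<subseteq> U \<and> sym_dist R {X..Y} \<le> c * card R"
  shows "\<exists>X Y. X \<subseteq> Y \<and> Y \<subseteq> U \<and>
    (16 * sym_dist P {X..Y} + 16 * card Q \<le> card P + card Q \<or>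
     16 * sym_dist P {X..Y} + 16 * sym_dist Q {X..Y} \<le> card P + card Q)"
proof -
  have fin: "finite P" "finite Q" using U by (meson finite_Pow_iff finite_subset)+
  define p q a where "p = real (card P)" and "q = real (card Q)" and "a = p + q"
  define d where "d = real (card (P \<inter> Q))"
  define r where "r = q / a"
  have p: "0 < p" "0 \<le> q" "q \<le> p" "0 < a"
    using \<open>P \<noteq> {}\<close> fin le by (auto simp: p_def q_def a_def card_gt_0_iff add_pos_nonneg)
  have r: "0 \<le> r" "r \<le> 1 / 2" "q = a * r" using p by (auto simp: r_def a_def field_simps)
  have ar: "a * (k * r) = k * q" for k using r(3) by simp
  have "d \<le> q" unfolding d_def q_def using fin by (simp add: card_mono)
  have nonneg: "0 \<le> deficit P" "0 \<le> deficit Q" using deficit_nonneg U by blast+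
  have D: "deficit P + deficit Q + a * bin_entropy r - 2 * d \<le> c * a"
    using deficit xlog_split[of a q] p by (simp add: a_def p_def q_def d_def r_def)
  show ?thesis
  proof (cases "r \<le> 1 / 32")
    case True
    then have "5 * r \<le> bin_entropy r" using bin_entropy_ge_linear[of r 5] r by simp
    then have "a * (5 * r) \<le> a * bin_entropy r" using p by (intro mult_left_mono) auto
    then have "deficit P \<le> c * a - 3 * q" using D nonneg \<open>d \<le> q\<close> unfolding ar by linarith
    also have "\<dots> \<le> c * p"
    proof -
      have "c * q \<le> 3 * q" using c p by (intro mult_right_mono) auto
      then show ?thesis by (simp add: a_def algebra_simps)
    qed
    finally have "deficit P \<le> c * p" .
    from IH[OF U(2) \<open>P \<noteq> {}\<close> this[unfolded p_def]]
    obtain X Y where XY: "X \<subseteq> Y" "Y \<subseteq> U" "sym_dist P {X..Y} \<le> c * p"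
      unfolding p_def by blast
    have "c * p \<le> p / 100" using mult_right_mono[of c "1 / 100" p] c p by simp
    moreover have "q \<le> a / 32" using True p by (simp add: r_def field_simps)
    ultimately have "16 * real (sym_dist P {X..Y}) + 16 * q \<le> p + q"
      using XY(3) p a_def by linarith
    then have "16 * sym_dist P {X..Y} + 16 * card Q \<le> card P + card Q"
      unfolding p_def q_def by linarith
    then show ?thesis using XY by blast
  next
    case False
    have "a * bin_entropy r - 2 * q \<le> c * a" using D nonneg \<open>d \<le> q\<close> by linarith
    then have "a * (bin_entropy r - 2 * r) \<le> a * c"
      unfolding right_diff_distrib ar by (simp add: mult.commute)
    then have "bin_entropy r - 2 * r \<le> c" using p by simp
    have "31 / 64 < r"
    proof (rule ccontr)
      assume "\<not> 31 / 64 < r"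
      then have "2 * r + \<gamma> \<le> bin_entropy r" using False by (intro gap) auto
      then show False using \<open>bin_entropy r - 2 * r \<le> c\<close> c(3) by linarith
    qed
    have "2 * r \<le> bin_entropy r" using r by (intro bin_entropy_ge) auto
    then have h: "a * (2 * r) \<le> a * bin_entropy r" using p by (intro mult_left_mono) auto
    \<comment> \<open>The distance of the whole family from the product cube will be at most
      \<open>2 * c * p\<close> plus this, which stays below \<open>a / 16\<close> because \<open>3 * c \<le> 3 / 100 < 1 / 32\<close>.\<close>
    have PQ: "sym_dist P Q \<le> a / 32 + c * a"
    proof -
      have "a * (31 / 32) \<le> a * (2 * r)" using \<open>31 / 64 < r\<close> p by (intro mult_left_mono) auto
      then have "a - 2 * d \<le> a / 32 + c * a" using h D nonneg by linarith
      then show ?thesis using sym_dist_eq[OF fin] by (simp add: a_def p_def q_def d_def)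
    qed
    have "deficit P + deficit Q \<le> c * p + c * q"
    proof -
      have "c * a = c * p + c * q" by (simp add: a_def distrib_left)
      then show ?thesis using D h \<open>d \<le> q\<close> unfolding ar by linarith
    qed
    moreover have "Q \<noteq> {}" using False r by (auto simp: r_def q_def)
    moreover have "deficit P \<le> c * p \<or> deficit Q \<le> c * q" using calculation(1) by linarith
    ultimately obtain R where R: "R = P \<or> R = Q" "R \<noteq> {}" "deficit R \<le> c * card R"
      using \<open>P \<noteq> {}\<close> unfolding p_def q_def by blast
    then have "R \<subseteq> Pow U" using U by blast
    from IH[OF this R(2,3)]
    obtain X Y where XY: "X \<subseteq> Y" "Y \<subseteq> U" "sym_dist R {X..Y} \<le> c * card R" by blast
    have finC: "finite {X..Y}"
      using XY(2) U(1) by (intro finite_cube) (rule finite_subset)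
    have "sym_dist P {X..Y} + sym_dist Q {X..Y}
        \<le> 2 * sym_dist R {X..Y} + sym_dist P Q"
      using R(1) sym_dist_triangle[OF fin(1) fin(2) finC] sym_dist_triangle[OF fin(2) fin(1) finC]
        sym_dist_commute[of Q P]
      by (elim disjE) simp_all
    moreover have "sym_dist R {X..Y} \<le> c * p"
    proof -
      have "c * card R \<le> c * p" using R(1) p c by (intro mult_left_mono) (auto simp: p_def q_def)
      then show ?thesis using XY(3) by linarith
    qed
    moreover have "c * p \<le> c * a" using c p by (intro mult_left_mono) (auto simp: a_def)
    moreover have "c * a \<le> a / 100" using mult_right_mono[of c "1 / 100" a] c p by simp
    ultimately have "16 * real (sym_dist P {X..Y}) + 16 * real (sym_dist Q {X..Y}) \<le> p + q"
      using PQ a_def p by linarith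
    then have "16 * sym_dist P {X..Y} + 16 * sym_dist Q {X..Y} \<le> card P + card Q"
      unfolding p_def q_def by linarith
    then show ?thesis using XY by blast
  qed
qed

text \<open>Induction on the ground set. The step \<open>cube_for_slices\<close> yields a cube at relative distance at most
  \<open>1 / 16\<close>: the cube found for a slice is used without the new element, with the new element added
  to all its sets, or with the new element left free. Then \<open>near_cube_self_improves\<close> brings the
  distance below the deficit, which restores the constant \<open>c\<close>.\<close>

theorem near_cube_of_small_deficit:
  "\<exists>c::real. 0 < c \<and> c \<le> 1 / 100 \<and> (\<forall>U (A :: 'a set set). finite U \<longrightarrow> A \<subseteq> Pow U \<longrightarrow> A \<noteq> {} \<longrightarrow>
     deficit A \<le> c * card A \<longrightarrow>
     (\<exists>X Y. X \<subseteq> Y \<and> Y \<subseteq> U \<and> sym_dist A {X..Y} \<le> c * card A))"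
proof -
  obtain \<gamma> where \<gamma>: "0 < \<gamma>" "\<And>r. 1 / 32 \<le> r \<Longrightarrow> r \<le> 31 / 64 \<Longrightarrow> 2 * r + \<gamma> \<le> bin_entropy r"
    using bin_entropy_gap by blast
  define c where "c = min (1 / 100) (\<gamma> / 2)"
  have c: "0 < c" "c \<le> 1 / 100" "c < \<gamma>" using \<gamma>(1) by (auto simp: c_def min_less_iff_disj)
  have "\<exists>X Y. X \<subseteq> Y \<and> Y \<subseteq> U \<and> sym_dist A {X..Y} \<le> c * card A"
    if "finite U" "A \<subseteq> Pow U" "A \<noteq> {}" "deficit A \<le> c * card A" for U and A :: "'a set set"
    using that
  proof (induction U arbitrary: A rule: finite_induct)
    case empty
    then have "A = {{}..{}}" by auto
    then show ?case using c by (intro exI[of _ "{}"]) (auto simp: sym_dist_def)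
  next
    case (insert i U)
    have fin: "finite A" using insert by (meson finite_Pow_iff finite_insert finite_subset)
    let ?L = "lower i A" and ?U = "upper i A"
    note sub = slices_Pow[OF insert.prems(1)]
    have cA: "card A = card ?L + card ?U" by (rule card_slices[OF fin])
    have "A \<noteq> {} \<Longrightarrow> card A > 0" using fin by (simp add: card_gt_0_iff)
    then have ne: "card ?U \<le> card ?L \<Longrightarrow> ?L \<noteq> {}" "card ?L \<le> card ?U \<Longrightarrow> ?U \<noteq> {}"
      using cA insert.prems(2) by auto
    have D: "deficit ?L + deficit ?U
      + (xlog (real (card ?L) + real (card ?U)) - xlog (card ?L) - xlog (card ?U))
      - 2 * real (card (?L \<inter> ?U)) \<le> c * (real (card ?L) + real (card ?U))"
      using insert.prems(3) deficit_slices[OF fin, of i] cA by simp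
    have split: "sym_dist A C = sym_dist ?L (lower i C) + sym_dist ?U (upper i C)"
      if "finite C" for C
      using card_slices[of "sym_diff A C" i] fin that by (simp add: slices_sym_diff sym_dist_def)
    have "\<exists>X Y. X \<subseteq> Y \<and> Y \<subseteq> insert i U \<and> 16 * sym_dist A {X..Y} \<le> card A"
    proof -
      have cubes: "finite {X..Y}" if "Y \<subseteq> insert i U" for X Y :: "'a set"
        using that insert.hyps(1) by (intro finite_cube) (meson finite_insert finite_subset)
      have wide: ?thesis if "X \<subseteq> Y" "Y \<subseteq> U"
        "16 * sym_dist ?L {X..Y} + 16 * sym_dist ?U {X..Y} \<le> card A" for X Y
      proof -
        have "i \<notin> Y" using that insert.hyps by auto
        then have "16 * sym_dist A {X..insert i Y} \<le> card A"
          using that split[OF cubes, of "insert i Y" X] by (simp add: slices_cube subset_insertI2)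
        moreover have "X \<subseteq> insert i Y" "insert i Y \<subseteq> insert i U" using that by auto
        ultimately show ?thesis by blast
      qed
      show ?thesis
      proof (cases "card ?U \<le> card ?L")
        case True
        from cube_for_slices[OF \<gamma>(2) c insert.hyps(1) sub True ne(1)[OF True] D insert.IH]
        obtain X Y where XY: "X \<subseteq> Y" "Y \<subseteq> U"
          "16 * sym_dist ?L {X..Y} + 16 * card ?U \<le> card A \<or>
           16 * sym_dist ?L {X..Y} + 16 * sym_dist ?U {X..Y} \<le> card A"
          unfolding cA by blast
        moreover have ?thesis if "16 * sym_dist ?L {X..Y} + 16 * card ?U \<le> card A"
        proof -
          have "i \<notin> Y" using XY insert.hyps by auto
          moreover have "Y \<subseteq> insert i U" using XY by auto
          ultimately have "16 * sym_dist A {X..Y} \<le> card A"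
            using XY(1) that split[OF cubes, of Y X] by (simp add: slices_cube sym_dist_def[of _ "{}"])
          then show ?thesis using XY(1) \<open>Y \<subseteq> insert i U\<close> by blast
        qed
        ultimately show ?thesis using wide by blast
      next
        case False
        then have le: "card ?L \<le> card ?U" by simp
        have D': "deficit ?U + deficit ?L
          + (xlog (real (card ?U) + real (card ?L)) - xlog (card ?U) - xlog (card ?L))
          - 2 * real (card (?U \<inter> ?L)) \<le> c * (real (card ?U) + real (card ?L))"
          using D by (simp add: Int_commute add.commute)
        from cube_for_slices[OF \<gamma>(2) c insert.hyps(1) sub(2,1) le ne(2)[OF le] D' insert.IH]
        obtain X Y where XY: "X \<subseteq> Y" "Y \<subseteq> U"
          "16 * sym_dist ?U {X..Y} + 16 * card ?L \<le> card A \<or>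
           16 * sym_dist ?L {X..Y} + 16 * sym_dist ?U {X..Y} \<le> card A"
          unfolding cA by (auto simp: add.commute)
        moreover have ?thesis if "16 * sym_dist ?U {X..Y} + 16 * card ?L \<le> card A"
        proof -
          have "i \<notin> Y" using XY insert.hyps by auto
          moreover have "insert i X \<subseteq> insert i Y" "insert i Y \<subseteq> insert i U" using XY by auto
          ultimately have "16 * sym_dist A {insert i X..insert i Y} \<le> card A"
            using XY(1) that split[OF cubes, of "insert i Y" "insert i X"]
            by (simp add: slices_cube add.commute sym_dist_def[of _ "{}"])
          then show ?thesis
            using \<open>insert i X \<subseteq> insert i Y\<close> \<open>insert i Y \<subseteq> insert i U\<close> by blast
        qed
        ultimately show ?thesis using wide by blast
      qed
    qed
    then obtain X Y where XY: "X \<subseteq> Y" "Y \<subseteq> insert i U" "16 * sym_dist A {X..Y} \<le> card A"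
      by blast
    have "sym_dist A {X..Y} \<le> deficit A"
      by (rule near_cube_self_improves[OF _ insert.prems(1) XY]) (use insert.hyps in simp)
    then show ?case using XY insert.prems(3) by (meson order.trans)
  qed
  then show ?thesis using c by blast
qed

text \<open>The cube from \<open>near_cube_of_small_deficit\<close> has the right dimension because its size is close to
  \<open>2 ^ k\<close>. Its relative distance \<open>x\<close> lies on the increasing branch of \<open>x * log 2 (1 / x)\<close>, so the
  bound of \<open>deficit_ge_same_size_cube\<close> turns into \<open>x \<le> delta1 \<epsilon>\<close>.\<close>

theorem near_cube_sharp:
  "\<exists>c::real. 0 < c \<and> (\<forall>U (A :: 'a set set) k (\<epsilon> :: real). finite U \<longrightarrow> A \<subseteq> Pow U \<longrightarrow>
     card A = 2 ^ k \<longrightarrow> 0 < \<epsilon> \<longrightarrow> \<epsilon> \<le> c \<longrightarrow> deficit A \<le> \<epsilon> * card A \<longrightarrow>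
     (\<exists>X Y. X \<subseteq> Y \<and> Y \<subseteq> U \<and> card (Y - X) = k \<and> sym_dist A {X..Y} \<le> delta1 \<epsilon> * card A))"
proof -
  obtain c :: real where c: "0 < c" "c \<le> 1 / 100"
    and stab: "\<And>U (A :: 'a set set). finite U \<Longrightarrow> A \<subseteq> Pow U \<Longrightarrow> A \<noteq> {} \<Longrightarrow>
      deficit A \<le> c * card A \<Longrightarrow>
      \<exists>X Y. X \<subseteq> Y \<and> Y \<subseteq> U \<and> sym_dist A {X..Y} \<le> c * card A"
    using near_cube_of_small_deficit by blast
  have "\<exists>X Y. X \<subseteq> Y \<and> Y \<subseteq> U \<and> card (Y - X) = k \<and> sym_dist A {X..Y} \<le> delta1 \<epsilon> * card A"
    if U: "finite U" "A \<subseteq> Pow U" and cardA: "card A = 2 ^ k" and \<epsilon>: "0 < \<epsilon>" "\<epsilon> \<le> c"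
      and deficit: "deficit A \<le> \<epsilon> * card A" for U and A :: "'a set set" and k and \<epsilon> :: real
  proof -
    define a where "a = real (card A)"
    have a: "0 < a" using cardA by (simp add: a_def)
    have "A \<noteq> {}" using cardA by auto
    have "\<epsilon> * a \<le> c * a" using \<epsilon> a by (intro mult_right_mono) auto
    then have "deficit A \<le> c * card A" using deficit by (simp add: a_def)
    from stab[OF U \<open>A \<noteq> {}\<close> this]
    obtain X Y where XY: "X \<subseteq> Y" "Y \<subseteq> U" "sym_dist A {X..Y} \<le> c * a" unfolding a_def by blast
    have finY: "finite Y" using XY(2) U(1) by (rule finite_subset)
    have fin: "finite A" "finite {X..Y}"
      using U finite_cube[OF finY] by (meson finite_Pow_iff finite_subset)+
    have card_cube_Y: "card {X..Y} = 2 ^ card (Y - X)" by (rule card_cube[OF finY XY(1)])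
    \<comment> \<open>The sizes of \<open>A\<close> and of the cube are powers of \<open>2\<close> that differ by a factor less than \<open>2\<close>.\<close>
    have dim: "card (Y - X) = k"
    proof -
      have "card A \<le> card ({X..Y} \<union> sym_diff A {X..Y})" using fin by (intro card_mono) auto
      also have "\<dots> \<le> card {X..Y} + card (sym_diff A {X..Y})" by (rule card_Un_le)
      finally have 1: "card A \<le> card {X..Y} + sym_dist A {X..Y}" by (simp add: sym_dist_def)
      have "card {X..Y} \<le> card (A \<union> sym_diff A {X..Y})" using fin by (intro card_mono) auto
      also have "\<dots> \<le> card A + card (sym_diff A {X..Y})" by (rule card_Un_le)
      finally have 2: "card {X..Y} \<le> card A + sym_dist A {X..Y}" by (simp add: sym_dist_def)
      have "c * a \<le> a / 100" using mult_right_mono[of c "1 / 100" a] c a by simp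
      then have "real (100 * sym_dist A {X..Y}) \<le> real (card A)" using XY(3) by (simp add: a_def)
      then have "100 * sym_dist A {X..Y} \<le> card A" by (simp only: of_nat_le_iff)
      moreover have "0 < card A" using cardA by simp
      ultimately have "card A < 2 * card {X..Y}" "card {X..Y} < 2 * card A" using 1 2 by linarith+
      then have "(2::nat) ^ k < 2 ^ Suc (card (Y - X))" "(2::nat) ^ card (Y - X) < 2 ^ Suc k"
        by (simp_all add: cardA card_cube_Y)
      then have "k < Suc (card (Y - X))" "card (Y - X) < Suc k"
        by (simp_all only: power_strict_increasing_iff one_less_numeral_iff semiring_norm)
      then show ?thesis by simp
    qed
    define x where "x = real (sym_dist A {X..Y}) / a"
    have "a * (x * log 2 (1 / x)) \<le> deficit A"
      using deficit_ge_same_size_cube[OF U XY(1,2)] by (simp add: x_def a_def card_cube_Y dim cardA)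
    also have "\<dots> \<le> a * \<epsilon>" using deficit by (simp add: a_def mult.commute)
    finally have bound: "x * log 2 (1 / x) \<le> \<epsilon>" using a by simp
    have "x \<le> c" using XY(3) a by (simp add: x_def pos_divide_le_eq)
    have third: "1 / 3 \<le> 1 / exp (1::real)" by (rule divide_left_mono[OF exp_le]) auto
    also have "\<dots> \<le> log 2 (exp 1) / exp 1"
      using log2_exp_bounds by (intro divide_right_mono) auto
    finally have "\<epsilon> < log 2 (exp 1) / exp 1" using \<epsilon> c by linarith
    moreover have "x < 1 / exp 1" using \<open>x \<le> c\<close> c third by linarith
    moreover have "0 \<le> x" using a by (simp add: x_def)
    ultimately have "x \<le> delta1 \<epsilon>" using \<epsilon>(1) bound by (intro le_delta1)
    then have "sym_dist A {X..Y} \<le> delta1 \<epsilon> * card A"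
      using a by (simp add: x_def pos_divide_le_eq a_def)
    then show ?thesis using XY(1,2) dim by blast
  qed
  then show ?thesis using c(1) by blast
qed

section \<open>Transfer to the hypercube\<close>

text \<open>A vertex of the cube is the characteristic function of a subset of \<open>{1..n}\<close>, restricted to
  \<open>{1..n}\<close> because the hypercube consists of extensional functions. Moving along an edge toggles one
  element, and intervals \<open>{X..Y}\<close> of sets become subcubes.\<close>

definition vertex :: "nat \<Rightarrow> nat set \<Rightarrow> nat \<Rightarrow> nat" where
  "vertex n S = (\<lambda>i\<in>{1..n}. if i \<in> S then 1 else 0)"

lemma vertex_eq_1_iff: "i \<in> {1..n} \<Longrightarrow> vertex n S i = 1 \<longleftrightarrow> i \<in> S"
  by (simp add: vertex_def)

lemma vertex_bij: "bij_betw (vertex n) (Pow {1..n}) (hypercube n)"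
proof (rule bij_betw_byWitness[where f' = "\<lambda>x. {i \<in> {1..n}. x i = 1}"])
  show "\<forall>S\<in>Pow {1..n}. {i \<in> {1..n}. vertex n S i = 1} = S"
  proof
    fix S assume "S \<in> Pow {1..n}"
    then have "i \<in> {1..n}" if "i \<in> S" for i using that by blast
    then have "i \<in> {i \<in> {1..n}. vertex n S i = 1} \<longleftrightarrow> i \<in> S" for i
      using vertex_eq_1_iff[of i n S] unfolding mem_Collect_eq by blast
    then show "{i \<in> {1..n}. vertex n S i = 1} = S" by (rule set_eqI)
  qed
  show "\<forall>x\<in>hypercube n. vertex n {i \<in> {1..n}. x i = 1} = x"
  proof
    fix x assume x: "x \<in> hypercube n"
    show "vertex n {i \<in> {1..n}. x i = 1} = x"
    proof
      fix i
      show "vertex n {i \<in> {1..n}. x i = 1} i = x i"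
      proof (cases "i \<in> {1..n}")
        case True
        have "x i \<in> {0, 1}" by (rule PiE_mem[OF x[unfolded hypercube_def] True])
        then show ?thesis using True by (auto simp: vertex_def)
      next
        case False
        then show ?thesis
          using PiE_arb[OF x[unfolded hypercube_def] False] by (simp only: vertex_def restrict_apply if_False)
      qed
    qed
  qed
  show "vertex n ` Pow {1..n} \<subseteq> hypercube n"
    by (rule image_subsetI) (simp add: vertex_def hypercube_def restrict_PiE_iff)
qed blast

lemma vertex_in_hypercube:
  assumes "S \<subseteq> {1..n}"
  shows "vertex n S \<in> hypercube n"
  by (rule bij_betwE[OF vertex_bij, rule_format]) (use assms in simp)

lemma hypercube_vertexE:
  assumes "x \<in> hypercube n"
  obtains S where "x = vertex n S" "S \<subseteq> {1..n}"
  using assms unfolding bij_betw_imp_surj_on[OF vertex_bij, symmetric] by blast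

lemma vertex_eq_iff:
  assumes "S \<subseteq> {1..n}" "T \<subseteq> {1..n}"
  shows "vertex n S = vertex n T \<longleftrightarrow> S = T"
  using inj_on_eq_iff[OF bij_betw_imp_inj_on[OF vertex_bij]] assms by simp

lemma eq_toggle_iff: "T = toggle i S \<longleftrightarrow> sym_diff S T = {i}"
proof -
  have "j \<in> toggle i S \<longleftrightarrow> (if j = i then i \<notin> S else j \<in> S)" for j
    by (simp add: toggle_def)
  then have "(j \<in> T \<longleftrightarrow> j \<in> toggle i S) \<longleftrightarrow> (j \<in> sym_diff S T \<longleftrightarrow> j \<in> {i})" for j
    by (cases "j = i") (simp_all, blast+)
  then show ?thesis unfolding set_eq_iff[of T] set_eq_iff[of "sym_diff S T"] by (simp only:)
qed

lemma differ_once_iff_toggle: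
  assumes "S \<subseteq> {1..n}" "T \<subseteq> {1..n}"
  shows "(\<exists>!i. i \<in> {1..n} \<and> vertex n S i \<noteq> vertex n T i) \<longleftrightarrow> (\<exists>i\<in>{1..n}. T = toggle i S)"
proof -
  have "vertex n S i \<noteq> vertex n T i \<longleftrightarrow> (i \<in> S \<longleftrightarrow> i \<notin> T)" if "i \<in> {1..n}" for i
    using that by (simp add: vertex_def)
  then have "i \<in> {1..n} \<and> vertex n S i \<noteq> vertex n T i \<longleftrightarrow> i \<in> sym_diff S T" for i
    using assms by blast
  then have "(\<exists>!i. i \<in> {1..n} \<and> vertex n S i \<noteq> vertex n T i) \<longleftrightarrow> (\<exists>!i. i \<in> sym_diff S T)"
    by (simp only:)
  also have "\<dots> \<longleftrightarrow> (\<exists>i. sym_diff S T = {i})"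
    unfolding Ex1_def set_eq_iff[of "sym_diff S T"] singleton_iff by blast
  also have "\<dots> \<longleftrightarrow> (\<exists>i. T = toggle i S)"
    by (simp only: eq_toggle_iff)
  also have "\<dots> \<longleftrightarrow> (\<exists>i\<in>{1..n}. T = toggle i S)"
  proof -
    have "i \<in> S \<or> i \<in> toggle i S" for i by (simp add: toggle_def)
    then show ?thesis using assms by blast
  qed
  finally show ?thesis .
qed

lemma edge_boundary_eq:
  assumes "F \<subseteq> Pow {1..n}"
  shows "edge_boundary n (vertex n ` F) =
    (\<lambda>(S, i). {vertex n S, vertex n (toggle i S)}) ` {(S, i). S \<in> F \<and> i \<in> {1..n} \<and> toggle i S \<notin> F}"
    (is "?B = ?g ` ?Z")
proof (rule equalityI; rule subsetI)
  fix e assume "e \<in> ?B"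
  then obtain x y where xy: "e = {x, y}" "x \<in> vertex n ` F" "y \<notin> vertex n ` F"
    and "e \<in> hypercube_edges n" unfolding edge_boundary_def by blast
  then obtain u v where uv: "e = {u, v}" "u \<in> hypercube n" "v \<in> hypercube n"
    and ex: "\<exists>!i. i \<in> {1..n} \<and> u i \<noteq> v i" unfolding hypercube_edges_def by blast
  have swap: "v i \<noteq> u i \<longleftrightarrow> u i \<noteq> v i" for i by (rule eq_commute[THEN arg_cong])
  have "x = u \<and> y = v \<or> x = v \<and> y = u" using xy(1) uv(1) doubleton_eq_iff[of x y u v] by simp
  then have "y \<in> hypercube n \<and> (\<exists>!i. i \<in> {1..n} \<and> x i \<noteq> y i)"
  proof
    assume "x = u \<and> y = v"
    then show ?thesis using uv(3) ex by simp
  next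
    assume "x = v \<and> y = u"
    moreover have "\<exists>!i. i \<in> {1..n} \<and> v i \<noteq> u i" unfolding swap by (rule ex)
    ultimately show ?thesis using uv(2) by simp
  qed
  then have "y \<in> hypercube n" and ex': "\<exists>!i. i \<in> {1..n} \<and> x i \<noteq> y i" by simp_all
  obtain T where T: "y = vertex n T" "T \<subseteq> {1..n}" by (rule hypercube_vertexE[OF \<open>y \<in> hypercube n\<close>])
  obtain S where S: "x = vertex n S" "S \<in> F" using xy(2) by blast
  then have "S \<subseteq> {1..n}" using assms by blast
  from ex'[unfolded S(1) T(1) differ_once_iff_toggle[OF this T(2)]]
  obtain i where i: "i \<in> {1..n}" "T = toggle i S" by (rule bexE)
  have "T \<notin> F" using xy(3) T(1) by blast
  then have "(S, i) \<in> ?Z" using S(2) i by simp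
  moreover have "e = ?g (S, i)" using xy(1) S(1) T(1) i(2) by simp
  ultimately show "e \<in> ?g ` ?Z" by (rule rev_image_eqI)
next
  fix e assume "e \<in> ?g ` ?Z"
  then obtain S i where S: "e = {vertex n S, vertex n (toggle i S)}" "S \<in> F" "i \<in> {1..n}" "toggle i S \<notin> F"
    by auto
  have sub: "S \<subseteq> {1..n}" using assms S(2) by blast
  then have sub': "toggle i S \<subseteq> {1..n}" using S(3) by (rule toggle_subset)
  have "vertex n S \<in> hypercube n" "vertex n (toggle i S) \<in> hypercube n"
    by (rule vertex_in_hypercube[OF sub], rule vertex_in_hypercube[OF sub'])
  moreover have "\<exists>!j. j \<in> {1..n} \<and> vertex n S j \<noteq> vertex n (toggle i S) j"
    unfolding differ_once_iff_toggle[OF sub sub'] by (rule bexI[OF refl S(3)])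
  ultimately have "e \<in> hypercube_edges n" unfolding hypercube_edges_def S(1) by blast
  moreover have "vertex n (toggle i S) \<notin> vertex n ` F"
  proof
    assume "vertex n (toggle i S) \<in> vertex n ` F"
    then obtain T where T: "vertex n (toggle i S) = vertex n T" "T \<in> F" by (rule imageE)
    then have "T \<subseteq> {1..n}" using assms by blast
    from T(1)[unfolded vertex_eq_iff[OF sub' this]] show False using T(2) S(4) by simp
  qed
  ultimately show "e \<in> ?B" unfolding edge_boundary_def S(1) using S(2) by blast
qed

text \<open>Of the \<open>n\<close> edges at a vertex of \<open>F\<close>, those that stay inside are counted by \<open>links F F\<close>. Every
  other one is a boundary edge, which has only one end in \<open>F\<close> and so is met once.\<close>

lemma card_edge_boundary:
  assumes "F \<subseteq> Pow {1..n}"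
  shows "card (edge_boundary n (vertex n ` F)) + links F F = n * card F"
proof -
  let ?Z = "{(S, i). S \<in> F \<and> i \<in> {1..n} \<and> toggle i S \<notin> F}"
  let ?W = "{(S, i). S \<in> F \<and> toggle i S \<in> F}"
  have fin: "finite F" using assms finite_subset by blast
  have "inj_on (\<lambda>(S, i). {vertex n S, vertex n (toggle i S)}) ?Z"
  proof -
    have "S = T \<and> i = j"
      if "S \<in> F" "i \<in> {1..n}" "toggle i S \<notin> F" "T \<in> F" "j \<in> {1..n}" "toggle j T \<notin> F"
        and eq: "{vertex n S, vertex n (toggle i S)} = {vertex n T, vertex n (toggle j T)}" for S T i j
    proof -
      have "S \<subseteq> {1..n}" "T \<subseteq> {1..n}" "toggle i S \<subseteq> {1..n}" "toggle j T \<subseteq> {1..n}"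
        using assms that(1,4) toggle_subset[OF _ that(2)] toggle_subset[OF _ that(5)] by blast+
      then have "S = T \<and> toggle i S = toggle j T \<or> S = toggle j T \<and> toggle i S = T"
        using eq by (simp add: doubleton_eq_iff vertex_eq_iff)
      moreover have "S \<noteq> toggle j T" using that by blast
      ultimately have "S = T" "toggle i S = toggle j T" by blast+
      then show ?thesis using toggle_inj[of i S j] by simp
    qed
    note unique = this
    show ?thesis
    proof (rule inj_onI)
      fix z w assume zw: "z \<in> ?Z" "w \<in> ?Z"
        and eq: "(\<lambda>(S, i). {vertex n S, vertex n (toggle i S)}) z
          = (\<lambda>(S, i). {vertex n S, vertex n (toggle i S)}) w"
      obtain S i T j where "z = (S, i)" "w = (T, j)" by (cases z, cases w)
      then show "z = w" using unique[of S i T j] zw eq by simp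
    qed
  qed
  then have "card (edge_boundary n (vertex n ` F)) = card ?Z"
    unfolding edge_boundary_eq[OF assms] by (rule card_image)
  moreover have "?W \<union> ?Z = F \<times> {1..n}"
  proof -
    have "i \<in> S \<or> i \<in> toggle i S" for i and S :: "nat set" by (simp add: toggle_def)
    then have "i \<in> {1..n}" if "S \<in> F" "toggle i S \<in> F" for S i using assms that by blast
    then show ?thesis by blast
  qed
  moreover have "finite ?Z" by (rule finite_subset[of _ "F \<times> {1..n}"]) (use fin in auto)
  then have "card (?W \<union> ?Z) = card ?W + card ?Z"
    using fin by (intro card_Un_disjoint) auto
  ultimately show ?thesis by (simp add: links_def card_cartesian_product mult.commute)
qed

lemma is_subcube_vertex_image:
  assumes "X \<subseteq> Y" "Y \<subseteq> {1..n}"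
  shows "is_subcube n (n - card (Y - X)) (vertex n ` {X..Y})"
  unfolding is_subcube_def
proof (intro exI conjI)
  \<comment> \<open>The elements of \<open>X\<close> are fixed to \<open>1\<close>, those outside \<open>Y\<close> to \<open>0\<close>.\<close>
  let ?S = "{1..n} - (Y - X)" and ?a = "\<lambda>i. if i \<in> X then 1 else 0 :: nat"
  show "?S \<subseteq> {1..n}" by blast
  have "finite (Y - X)" using assms by (meson finite_Diff finite_atLeastAtMost finite_subset)
  then show "card ?S = n - card (Y - X)" using assms by (subst card_Diff_subset) auto
  show "?a \<in> ?S \<rightarrow> {0, 1}" by auto
  have agree: "(\<forall>i\<in>?S. vertex n S i = ?a i) \<longleftrightarrow> S \<in> {X..Y}" if "S \<subseteq> {1..n}" for S
  proof -
    have "vertex n S i = ?a i \<longleftrightarrow> (i \<in> S \<longleftrightarrow> i \<in> X)" if "i \<in> ?S" for i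
      using that by (simp add: vertex_def)
    then have "(\<forall>i\<in>?S. vertex n S i = ?a i) \<longleftrightarrow> (\<forall>i\<in>?S. i \<in> S \<longleftrightarrow> i \<in> X)" by (rule ball_cong[OF refl])
    also have "\<dots> \<longleftrightarrow> X \<subseteq> S \<and> S \<subseteq> Y" using assms that by blast
    finally show ?thesis by simp
  qed
  show "vertex n ` {X..Y} = {x \<in> hypercube n. \<forall>i\<in>?S. x i = ?a i}"
  proof (intro equalityI subsetI)
    fix x assume "x \<in> vertex n ` {X..Y}"
    then obtain S where S: "x = vertex n S" "S \<in> {X..Y}" by (rule imageE)
    then have sub: "S \<subseteq> {1..n}" using cube_subset_Pow[OF assms(2), of X] by blast
    then show "x \<in> {x \<in> hypercube n. \<forall>i\<in>?S. x i = ?a i}"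
      unfolding S(1) mem_Collect_eq agree[OF sub] using S(2) vertex_in_hypercube by blast
  next
    fix x assume "x \<in> {x \<in> hypercube n. \<forall>i\<in>?S. x i = ?a i}"
    then have x: "x \<in> hypercube n" "\<forall>i\<in>?S. x i = ?a i" by simp_all
    obtain S where S: "x = vertex n S" "S \<subseteq> {1..n}" by (rule hypercube_vertexE[OF x(1)])
    from x(2)[unfolded S(1) agree[OF S(2)]] show "x \<in> vertex n ` {X..Y}" unfolding S(1) by (rule imageI)
  qed
qed

theorem theorem9:
  "\<exists>c::real. c > 0 \<and>
     (\<forall>(n::nat) (N::nat) (A::(nat \<Rightarrow> nat) set) (\<epsilon>::real).
        n > 0 \<longrightarrow> A \<subseteq> hypercube n \<longrightarrow> N \<le> n \<longrightarrow> card A = 2 ^ (n - N) \<longrightarrow>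
        0 < \<epsilon> \<longrightarrow> \<epsilon> \<le> c \<longrightarrow>
        real (card (edge_boundary n A))
          \<le> real (card A) * log 2 (2 ^ n / real (card A)) + \<epsilon> * real (card A) \<longrightarrow>
        (\<exists>C. is_subcube n N C \<and>
             real (card (sym_diff A C)) \<le> delta1 \<epsilon> * real (card A)))"
proof -
  obtain c :: real where c: "0 < c"
    and sharp: "\<And>U (F :: nat set set) k (\<epsilon> :: real). finite U \<Longrightarrow> F \<subseteq> Pow U \<Longrightarrow> card F = 2 ^ k \<Longrightarrow>
      0 < \<epsilon> \<Longrightarrow> \<epsilon> \<le> c \<Longrightarrow> deficit F \<le> \<epsilon> * card F \<Longrightarrow>
      \<exists>X Y. X \<subseteq> Y \<and> Y \<subseteq> U \<and> card (Y - X) = k \<and> sym_dist F {X..Y} \<le> delta1 \<epsilon> * card F"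
    using near_cube_sharp by blast
  have "\<exists>C. is_subcube n N C \<and> real (card (sym_diff A C)) \<le> delta1 \<epsilon> * real (card A)"
    if A: "A \<subseteq> hypercube n" "N \<le> n" "card A = 2 ^ (n - N)" and \<epsilon>: "0 < \<epsilon>" "\<epsilon> \<le> c"
      and bd: "real (card (edge_boundary n A))
        \<le> real (card A) * log 2 (2 ^ n / real (card A)) + \<epsilon> * real (card A)"
    for n N A \<epsilon>
  proof -
    define F where "F = {S \<in> Pow {1..n}. vertex n S \<in> A}"
    have F: "F \<subseteq> Pow {1..n}" unfolding F_def by blast
    have "A \<subseteq> vertex n ` Pow {1..n}"
      using A(1) unfolding bij_betw_imp_surj_on[OF vertex_bij] .
    then have A_eq: "A = vertex n ` F" by (auto simp: F_def)
    have inj: "inj_on (vertex n) (Pow {1..n})" by (rule bij_betw_imp_inj_on[OF vertex_bij])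
    have card_image_vertex: "card (vertex n ` G) = card G" if "G \<subseteq> Pow {1..n}" for G
      by (rule card_image[OF inj_on_subset[OF inj that]])
    have cardF: "card F = card A" unfolding A_eq by (rule card_image_vertex[OF F, symmetric])
    define a where "a = real (card A)"
    have a: "a = 2 ^ (n - N)" "0 < a" using A(3) by (simp_all add: a_def)
    have log_a: "log 2 a = real n - real N"
      using A(2) by (simp add: a log_nat_power of_nat_diff)
    have "deficit F \<le> \<epsilon> * card F"
    proof -
      have "real (card (edge_boundary n A)) + real (links F F) = real n * a"
        using arg_cong[OF card_edge_boundary[OF F], of real] by (simp add: A_eq[symmetric] a_def cardF)
      moreover have "log 2 (2 ^ n / a) = real N"
        using a(2) log_a by (simp add: log_divide log_nat_power)
      then have "real (card (edge_boundary n A)) \<le> a * real N + \<epsilon> * a"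
        using bd by (simp add: a_def)
      moreover have "xlog a = a * real n - a * real N" by (simp add: xlog_def log_a right_diff_distrib)
      moreover have "real n * a = a * real n" by (rule mult.commute)
      ultimately show ?thesis unfolding deficit_def cardF a_def[symmetric] by linarith
    qed
    from sharp[OF finite_atLeastAtMost F cardF[unfolded A(3)] \<epsilon> this]
    obtain X Y where XY: "X \<subseteq> Y" "Y \<subseteq> {1..n}" "card (Y - X) = n - N"
      and close: "sym_dist F {X..Y} \<le> delta1 \<epsilon> * card F" by blast
    have cube_sub: "{X..Y} \<subseteq> Pow {1..n}" by (rule cube_subset_Pow[OF XY(2)])
    have sub: "F - {X..Y} \<subseteq> Pow {1..n}" "{X..Y} - F \<subseteq> Pow {1..n}"
      by (rule order.trans[OF Diff_subset F], rule order.trans[OF Diff_subset cube_sub])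
    have "sym_diff A (vertex n ` {X..Y}) = vertex n ` sym_diff F {X..Y}"
      unfolding A_eq image_Un inj_on_image_set_diff[OF inj sub(1) cube_sub]
        inj_on_image_set_diff[OF inj sub(2) F] ..
    moreover have "sym_diff F {X..Y} \<subseteq> Pow {1..n}" by (rule Un_least[OF sub])
    ultimately have "card (sym_diff A (vertex n ` {X..Y})) = sym_dist F {X..Y}"
      using card_image_vertex by (simp only: sym_dist_def)
    then have "real (card (sym_diff A (vertex n ` {X..Y}))) \<le> delta1 \<epsilon> * real (card A)"
      using close by (simp only: cardF)
    moreover have "is_subcube n N (vertex n ` {X..Y})"
      using is_subcube_vertex_image[OF XY(1,2)] A(2) by (simp add: XY(3))
    ultimately show ?thesis by blast
  qed
  then show ?thesis using c by blast
qed

end
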